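(* Let $\Omega$ be a finite index set, let $\{A_i\}_{i\in\Omega}$ be a family of MV-algebras, and let $A=\prod_{i\in\Omega}A_i$ be their direct product. Then $$\Bigl\{\prod_{i\in\Omega}I_i \;\Big|\; I_i\in\mathrm{Ideal}(A_i)\text{ for all } i\in\Omega\Bigr\}=\mathrm{Ideal}(A),$$ where $\prod_{i\in\Omega}I_i$ denotes the cartesian product of the sets $I_i$.
   Context: An MV-algebra is an algebra $(A,\oplus,*,0)$ of type $(2,1,0)$ such that $(A,\oplus,0)$ is a commutative monoid, $x^{**}=x$, $x\oplus 0^*=0^*$, and $(x^*\oplus y)^*\oplus y=(y^*\oplus x)^*\oplus x$ for all $x,y$. Put $1=0^*$ and $x\le y$ iff $x^*\oplus y=1$ (a partial order). The direct product of MV-algebras is the cartesian product with pointwise operations. An ideal of $A$ is a subset $I\subseteq A$ with $0\in I$; $a,b\in I$ implies $a\oplus b\in I$; and $b\in I$, $a\le b$ implies $a\in I$. $\mathrm{Ideal}(A)$ denotes the set of all ideals of $A$. *)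

theory Defs
  imports "HOL-Algebra.Group" "HOL-Library.FuncSet"
begin

record 'a mv = "'a partial_object" +
  oplus :: "['a, 'a] \<Rightarrow> 'a" (infixl \<open>\<oplus>\<index>\<close> 65)
  star :: "'a \<Rightarrow> 'a" (\<open>\<sim>\<index> _\<close> [81] 80)
  mv_zero :: 'a (\<open>\<zero>\<index>\<close>)

definition mv_one :: "('a, 'm) mv_scheme \<Rightarrow> 'a" (\<open>\<one>m\<index>\<close>)
  where "\<one>m\<^bsub>A\<^esub> = \<sim>\<^bsub>A\<^esub> \<zero>\<^bsub>A\<^esub>"

definition mv_le :: "('a, 'm) mv_scheme \<Rightarrow> 'a \<Rightarrow> 'a \<Rightarrow> bool" (infix \<open>\<sqsubseteq>\<index>\<close> 50)
  where "x \<sqsubseteq>\<^bsub>A\<^esub> y \<longleftrightarrow> \<sim>\<^bsub>A\<^esub> x \<oplus>\<^bsub>A\<^esub> y = \<one>m\<^bsub>A\<^esub>"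

definition oplus_monoid :: "('a, 'm) mv_scheme \<Rightarrow> 'a monoid"
  where "oplus_monoid A = \<lparr>carrier = carrier A, mult = oplus A, one = mv_zero A\<rparr>"

locale mv_algebra =
  fixes A :: "('a, 'm) mv_scheme" (structure)
  assumes oplus_comm_monoid: "comm_monoid (oplus_monoid A)"
    and star_closed: "x \<in> carrier A \<Longrightarrow> \<sim> x \<in> carrier A"
    and star_star: "x \<in> carrier A \<Longrightarrow> \<sim> (\<sim> x) = x"
    and oplus_star_zero: "x \<in> carrier A \<Longrightarrow> x \<oplus> \<sim> \<zero> = \<sim> \<zero>"
    and lukasiewicz: "\<lbrakk>x \<in> carrier A; y \<in> carrier A\<rbrakk> \<Longrightarrow>
      \<sim> (\<sim> x \<oplus> y) \<oplus> y = \<sim> (\<sim> y \<oplus> x) \<oplus> x"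

definition mv_ideals :: "('a, 'm) mv_scheme \<Rightarrow> 'a set set"
  where "mv_ideals A = {I. I \<subseteq> carrier A \<and> \<zero>\<^bsub>A\<^esub> \<in> I \<and>
    (\<forall>a\<in>I. \<forall>b\<in>I. a \<oplus>\<^bsub>A\<^esub> b \<in> I) \<and>
    (\<forall>b\<in>I. \<forall>a\<in>carrier A. a \<sqsubseteq>\<^bsub>A\<^esub> b \<longrightarrow> a \<in> I)}"

text \<open>Elements of the product are extensional functions on the index set, so that equality
  in the product is equality of all components.\<close>

definition mv_prod :: "'i set \<Rightarrow> ('i \<Rightarrow> ('a, 'm) mv_scheme) \<Rightarrow> ('i \<Rightarrow> 'a) mv"
  where "mv_prod \<Omega> A = \<lparr>
    carrier = (\<Pi>\<^sub>E i\<in>\<Omega>. carrier (A i)),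
    oplus = (\<lambda>x y. \<lambda>i\<in>\<Omega>. x i \<oplus>\<^bsub>A i\<^esub> y i),
    star = (\<lambda>x. \<lambda>i\<in>\<Omega>. \<sim>\<^bsub>A i\<^esub> x i),
    mv_zero = (\<lambda>i\<in>\<Omega>. \<zero>\<^bsub>A i\<^esub>)\<rparr>"

lemma mv_algebra_mv_prod:
  assumes "\<And>i. i \<in> \<Omega> \<Longrightarrow> mv_algebra (A i)"
  shows "mv_algebra (mv_prod \<Omega> A)"
proof -
  note ax = assms[THEN mv_algebra.oplus_comm_monoid]
  have cl: "i \<in> \<Omega> \<Longrightarrow> x \<in> carrier (A i) \<Longrightarrow> y \<in> carrier (A i) \<Longrightarrow> oplus (A i) x y \<in> carrier (A i)" 
    for i x y
    using monoid.m_closed[OF comm_monoid.axioms(1)[OF ax]] by (auto simp: oplus_monoid_def)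
  have zc: "i \<in> \<Omega> \<Longrightarrow> mv_zero (A i) \<in> carrier (A i)" for i
    using monoid.one_closed[OF comm_monoid.axioms(1)[OF ax]] by (auto simp: oplus_monoid_def)
  have as: "i \<in> \<Omega> \<Longrightarrow> x \<in> carrier (A i) \<Longrightarrow> y \<in> carrier (A i) \<Longrightarrow> z \<in> carrier (A i) \<Longrightarrow>
     oplus (A i) (oplus (A i) x y) z = oplus (A i) x (oplus (A i) y z)" for i x y z
    using monoid.m_assoc[OF comm_monoid.axioms(1)[OF ax]] by (auto simp: oplus_monoid_def)
  have co: "i \<in> \<Omega> \<Longrightarrow> x \<in> carrier (A i) \<Longrightarrow> y \<in> carrier (A i) \<Longrightarrow>
     oplus (A i) x y = oplus (A i) y x" for i x y
    using comm_monoid.m_comm[OF ax] by (auto simp: oplus_monoid_def)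
  have zl: "i \<in> \<Omega> \<Longrightarrow> x \<in> carrier (A i) \<Longrightarrow> oplus (A i) (mv_zero (A i)) x = x" for i x
    using monoid.l_one[OF comm_monoid.axioms(1)[OF ax]] by (auto simp: oplus_monoid_def)
  show ?thesis
  proof (rule mv_algebra.intro)
    show "comm_monoid (oplus_monoid (mv_prod \<Omega> A))"
    proof (rule comm_monoidI, goal_cases)
      case (3 x y z)
      then show ?case
        by (intro ext) (auto simp: oplus_monoid_def mv_prod_def restrict_def PiE_iff intro!: as)
    next
      case (4 x)
      then show ?case
        by (intro ext) (auto simp: oplus_monoid_def mv_prod_def restrict_def PiE_iff extensional_def intro!: zl)
    next
      case (5 x y)
      then show ?case
        by (intro ext) (auto simp: oplus_monoid_def mv_prod_def restrict_def PiE_iff intro!: co)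
    qed (auto simp: oplus_monoid_def mv_prod_def PiE_iff intro!: cl zc)
  next
    fix x assume "x \<in> carrier (mv_prod \<Omega> A)"
    then show "star (mv_prod \<Omega> A) x \<in> carrier (mv_prod \<Omega> A)"
      by (auto simp: mv_prod_def PiE_iff assms mv_algebra.star_closed)
  next
    fix x assume "x \<in> carrier (mv_prod \<Omega> A)"
    then show "star (mv_prod \<Omega> A) (star (mv_prod \<Omega> A) x) = x"
      by (auto simp: mv_prod_def PiE_iff extensional_def restrict_def fun_eq_iff
          assms mv_algebra.star_star)
  next
    fix x assume "x \<in> carrier (mv_prod \<Omega> A)"
    then show "oplus (mv_prod \<Omega> A) x (star (mv_prod \<Omega> A) (mv_zero (mv_prod \<Omega> A)))
        = star (mv_prod \<Omega> A) (mv_zero (mv_prod \<Omega> A))"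
      by (auto simp: mv_prod_def PiE_iff restrict_def fun_eq_iff
          assms mv_algebra.oplus_star_zero)
  next
    fix x y assume "x \<in> carrier (mv_prod \<Omega> A)" "y \<in> carrier (mv_prod \<Omega> A)"
    then show "oplus (mv_prod \<Omega> A) (star (mv_prod \<Omega> A) (oplus (mv_prod \<Omega> A)
          (star (mv_prod \<Omega> A) x) y)) y
        = oplus (mv_prod \<Omega> A) (star (mv_prod \<Omega> A) (oplus (mv_prod \<Omega> A)
          (star (mv_prod \<Omega> A) y) x)) x"
      by (auto simp: mv_prod_def PiE_iff restrict_def fun_eq_iff
          intro!: assms mv_algebra.lukasiewicz)
  qed
qed

end

(* An ideal J of the product is recovered from its slices I i = {a. the vector with entry a at i
   and 0 elsewhere lies in J}: such a vector built from x i lies below x, and, the index set being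
   finite, x is the sum of these vectors. *)
theory Submission imports Defs begin

lemma (in mv_algebra)
  shows zero_closed: "\<zero> \<in> carrier A"
    and oplus_closed: "\<lbrakk>x \<in> carrier A; y \<in> carrier A\<rbrakk> \<Longrightarrow> x \<oplus> y \<in> carrier A"
    and oplus_commute: "\<lbrakk>x \<in> carrier A; y \<in> carrier A\<rbrakk> \<Longrightarrow> x \<oplus> y = y \<oplus> x"
    and zero_oplus: "x \<in> carrier A \<Longrightarrow> \<zero> \<oplus> x = x"
    and oplus_zero: "x \<in> carrier A \<Longrightarrow> x \<oplus> \<zero> = x"
proof -
  interpret M: comm_monoid "oplus_monoid A" by (rule oplus_comm_monoid)
  show "\<zero> \<in> carrier A" using M.one_closed by (simp add: oplus_monoid_def)
  show "x \<oplus> y \<in> carrier A" if "x \<in> carrier A" "y \<in> carrier A"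
    using M.m_closed that by (simp add: oplus_monoid_def)
  show "x \<oplus> y = y \<oplus> x" if "x \<in> carrier A" "y \<in> carrier A"
    using M.m_comm that by (simp add: oplus_monoid_def)
  show "\<zero> \<oplus> x = x" if "x \<in> carrier A" using M.l_one that by (simp add: oplus_monoid_def)
  show "x \<oplus> \<zero> = x" if "x \<in> carrier A" using M.r_one that by (simp add: oplus_monoid_def)
qed

text \<open>Take \<open>y = \<sim> \<zero>\<close> in the Lukasiewicz axiom: the left side is
  absorbed to \<open>\<sim> \<zero>\<close>, while the right side reduces to
  \<open>\<sim> x \<oplus> x\<close>.\<close>

lemma (in mv_algebra) mv_le_refl:
  assumes "x \<in> carrier A"
  shows "x \<sqsubseteq> x"
  using lukasiewicz[of x "\<sim> \<zero>"] assms
  by (simp add: mv_le_def mv_one_def oplus_star_zero star_closed star_star zero_closed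
      oplus_closed zero_oplus)

lemma (in mv_algebra) zero_mv_le:
  assumes "x \<in> carrier A"
  shows "\<zero> \<sqsubseteq> x"
  using assms
  by (simp add: mv_le_def mv_one_def oplus_commute[of "\<sim> \<zero>"] star_closed zero_closed
      oplus_star_zero)

lemma carrier_mv_prod: "carrier (mv_prod \<Omega> A) = (\<Pi>\<^sub>E i\<in>\<Omega>. carrier (A i))"
  by (simp add: mv_prod_def)

lemma oplus_mv_prod: "x \<oplus>\<^bsub>mv_prod \<Omega> A\<^esub> y = (\<lambda>i\<in>\<Omega>. x i \<oplus>\<^bsub>A i\<^esub> y i)"
  by (simp add: mv_prod_def)

lemma mv_zero_mv_prod: "\<zero>\<^bsub>mv_prod \<Omega> A\<^esub> = (\<lambda>i\<in>\<Omega>. \<zero>\<^bsub>A i\<^esub>)"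
  by (simp add: mv_prod_def)

text \<open>The order is an equation between two functions restricted to \<open>\<Omega>\<close>,
  hence one equation for each index.\<close>

lemma mv_le_mv_prod: "x \<sqsubseteq>\<^bsub>mv_prod \<Omega> A\<^esub> y \<longleftrightarrow> (\<forall>i\<in>\<Omega>. x i \<sqsubseteq>\<^bsub>A i\<^esub> y i)"
  by (auto simp: mv_le_def mv_one_def mv_prod_def fun_eq_iff restrict_def)

lemma PiE_mv_ideals:
  assumes "\<And>i. i \<in> \<Omega> \<Longrightarrow> I i \<in> mv_ideals (A i)"
  shows "(\<Pi>\<^sub>E i\<in>\<Omega>. I i) \<in> mv_ideals (mv_prod \<Omega> A)"
  using assms
  by (fastforce simp: mv_ideals_def carrier_mv_prod oplus_mv_prod mv_zero_mv_prod mv_le_mv_prod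
      PiE_iff)

text \<open>The set \<open>S\<close> lets one function give both the one-coordinate vectors and
  their partial sums. The argument \<open>x\<close> may be any function, so a constant one places a
  single element at a chosen index.\<close>

definition mv_cut :: "'i set \<Rightarrow> ('i \<Rightarrow> ('a, 'm) mv_scheme) \<Rightarrow> 'i set \<Rightarrow> ('i \<Rightarrow> 'a) \<Rightarrow> 'i \<Rightarrow> 'a"
  where "mv_cut \<Omega> A S x = (\<lambda>j\<in>\<Omega>. if j \<in> S then x j else \<zero>\<^bsub>A j\<^esub>)"

definition mv_slice ::
    "'i set \<Rightarrow> ('i \<Rightarrow> ('a, 'm) mv_scheme) \<Rightarrow> ('i \<Rightarrow> 'a) set \<Rightarrow> 'i \<Rightarrow> 'a set"
  where "mv_slice \<Omega> A J i = {a \<in> carrier (A i). mv_cut \<Omega> A {i} (\<lambda>_. a) \<in> J}"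

context
  fixes \<Omega> :: "'i set" and A :: "'i \<Rightarrow> ('a, 'm) mv_scheme"
  assumes mv: "\<And>i. i \<in> \<Omega> \<Longrightarrow> mv_algebra (A i)"
begin

lemma mv_cut_closed:
  assumes "\<And>i. i \<in> \<Omega> \<inter> S \<Longrightarrow> x i \<in> carrier (A i)"
  shows "mv_cut \<Omega> A S x \<in> carrier (mv_prod \<Omega> A)"
  using assms by (auto simp: mv_cut_def carrier_mv_prod mv mv_algebra.zero_closed)

lemma mv_cut_oplus:
  "mv_cut \<Omega> A S x \<oplus>\<^bsub>mv_prod \<Omega> A\<^esub> mv_cut \<Omega> A S y = mv_cut \<Omega> A S (\<lambda>i. x i \<oplus>\<^bsub>A i\<^esub> y i)"
  by (auto simp: mv_cut_def oplus_mv_prod fun_eq_iff mv mv_algebra.zero_oplus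
      mv_algebra.zero_closed)

text \<open>Disjointness leaves at each index at least one summand equal to zero. On an overlap the
  sum would contain \<open>x j\<close> added to itself, which in an MV-algebra need not be
  \<open>x j\<close>.\<close>

lemma mv_cut_Un:
  assumes "x \<in> carrier (mv_prod \<Omega> A)" and "S \<inter> T = {}"
  shows "mv_cut \<Omega> A S x \<oplus>\<^bsub>mv_prod \<Omega> A\<^esub> mv_cut \<Omega> A T x = mv_cut \<Omega> A (S \<union> T) x"
  using assms
  by (auto simp: mv_cut_def oplus_mv_prod carrier_mv_prod fun_eq_iff mv mv_algebra.zero_oplus
      mv_algebra.oplus_zero mv_algebra.zero_closed PiE_iff)

text \<open>Placing an element at index \<open>i\<close> with zeros elsewhere preserves zero, sums
  and order, so each ideal condition is pulled back from \<open>J\<close>.\<close>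

lemma mv_slice_mv_ideals:
  assumes J: "J \<in> mv_ideals (mv_prod \<Omega> A)" and i: "i \<in> \<Omega>"
  shows "mv_slice \<Omega> A J i \<in> mv_ideals (A i)"
proof -
  interpret Ai: mv_algebra "A i" using mv i .
  have "mv_cut \<Omega> A {i} (\<lambda>_. \<zero>\<^bsub>A i\<^esub>) = \<zero>\<^bsub>mv_prod \<Omega> A\<^esub>"
    by (auto simp: mv_cut_def mv_zero_mv_prod fun_eq_iff)
  then have "\<zero>\<^bsub>A i\<^esub> \<in> mv_slice \<Omega> A J i"
    using J by (simp add: mv_slice_def mv_ideals_def Ai.zero_closed)
  moreover have "a \<oplus>\<^bsub>A i\<^esub> b \<in> mv_slice \<Omega> A J i"
    if "a \<in> mv_slice \<Omega> A J i" "b \<in> mv_slice \<Omega> A J i" for a b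
  proof -
    have "mv_cut \<Omega> A {i} (\<lambda>_. a) \<oplus>\<^bsub>mv_prod \<Omega> A\<^esub> mv_cut \<Omega> A {i} (\<lambda>_. b) \<in> J"
      using that J by (simp add: mv_slice_def mv_ideals_def)
    \<comment> \<open>The sum supplied by \<open>mv_cut_oplus\<close> uses the operation of
      \<open>A j\<close> with varying \<open>j\<close>; the cut reads it only at
      \<open>j = i\<close>.\<close>
    moreover have "mv_cut \<Omega> A {i} (\<lambda>j. a \<oplus>\<^bsub>A j\<^esub> b) = mv_cut \<Omega> A {i} (\<lambda>_. a \<oplus>\<^bsub>A i\<^esub> b)"
      by (auto simp: mv_cut_def fun_eq_iff)
    ultimately show ?thesis
      using that by (simp add: mv_slice_def mv_cut_oplus Ai.oplus_closed)
  qed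
  moreover have "a \<in> mv_slice \<Omega> A J i"
    if b: "b \<in> mv_slice \<Omega> A J i" and a: "a \<in> carrier (A i)" and le: "a \<sqsubseteq>\<^bsub>A i\<^esub> b" for a b
  proof -
    \<comment> \<open>At index \<open>i\<close> this is \<open>le\<close>; at every other index it
      compares zero with itself, whence the appeal to reflexivity.\<close>
    have "mv_cut \<Omega> A {i} (\<lambda>_. a) \<sqsubseteq>\<^bsub>mv_prod \<Omega> A\<^esub> mv_cut \<Omega> A {i} (\<lambda>_. b)"
      using le by (auto simp: mv_cut_def mv_le_mv_prod mv mv_algebra.mv_le_refl
          mv_algebra.zero_closed)
    moreover have "mv_cut \<Omega> A {i} (\<lambda>_. a) \<in> carrier (mv_prod \<Omega> A)"
      using a by (auto intro: mv_cut_closed)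
    ultimately show ?thesis
      using a b J by (auto simp: mv_slice_def mv_ideals_def)
  qed
  ultimately show ?thesis
    by (auto simp: mv_ideals_def) (auto simp: mv_slice_def)
qed

text \<open>Each coordinate of the cut is either that of \<open>x\<close> or zero, so the cut lies
  below \<open>x\<close> and downward closure of \<open>J\<close> applies.\<close>

lemma mv_cut_in_ideal:
  assumes J: "J \<in> mv_ideals (mv_prod \<Omega> A)" and x: "x \<in> J"
  shows "mv_cut \<Omega> A S x \<in> J"
proof -
  have xi: "x i \<in> carrier (A i)" if "i \<in> \<Omega>" for i
    using J x that by (auto simp: mv_ideals_def carrier_mv_prod PiE_iff)
  then have "mv_cut \<Omega> A S x \<in> carrier (mv_prod \<Omega> A)"
    by (intro mv_cut_closed) auto
  moreover have "mv_cut \<Omega> A S x \<sqsubseteq>\<^bsub>mv_prod \<Omega> A\<^esub> x"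
    using xi by (auto simp: mv_cut_def mv_le_mv_prod mv mv_algebra.mv_le_refl
        mv_algebra.zero_mv_le)
  ultimately show ?thesis
    using J x by (auto simp: mv_ideals_def)
qed

lemma PiE_mv_slice:
  assumes "finite \<Omega>" and J: "J \<in> mv_ideals (mv_prod \<Omega> A)"
  shows "(\<Pi>\<^sub>E i\<in>\<Omega>. mv_slice \<Omega> A J i) = J"
proof
  \<comment> \<open>The slice is defined through constant functions, whereas the sums below cut
    \<open>x\<close> itself; only coordinate \<open>i\<close> is read, so the two agree.\<close>
  have cut_single: "mv_cut \<Omega> A {i} (\<lambda>_. x i) = mv_cut \<Omega> A {i} x" for x i
    by (auto simp: mv_cut_def fun_eq_iff)
  show "J \<subseteq> (\<Pi>\<^sub>E i\<in>\<Omega>. mv_slice \<Omega> A J i)"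
  proof
    fix x assume "x \<in> J"
    then have "mv_cut \<Omega> A {i} x \<in> J" for i
      by (rule mv_cut_in_ideal[OF J])
    moreover have "x \<in> carrier (mv_prod \<Omega> A)"
      using J \<open>x \<in> J\<close> by (auto simp: mv_ideals_def)
    ultimately show "x \<in> (\<Pi>\<^sub>E i\<in>\<Omega>. mv_slice \<Omega> A J i)"
      by (auto simp: mv_slice_def carrier_mv_prod PiE_iff cut_single)
  qed
  show "(\<Pi>\<^sub>E i\<in>\<Omega>. mv_slice \<Omega> A J i) \<subseteq> J"
  proof
    fix x assume x: "x \<in> (\<Pi>\<^sub>E i\<in>\<Omega>. mv_slice \<Omega> A J i)"
    then have xc: "x \<in> carrier (mv_prod \<Omega> A)"
      by (auto simp: mv_slice_def carrier_mv_prod PiE_iff)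
    \<comment> \<open>\<open>x\<close> is assembled one coordinate at a time. The condition
      \<open>S \<subseteq> \<Omega>\<close> ensures that the slice at each new index
      \<open>k\<close> contains \<open>x k\<close>.\<close>
    have "mv_cut \<Omega> A S x \<in> J" if "finite S" "S \<subseteq> \<Omega>" for S
      using that
    proof (induction S)
      case empty
      have "mv_cut \<Omega> A {} x = \<zero>\<^bsub>mv_prod \<Omega> A\<^esub>"
        by (simp add: mv_cut_def mv_zero_mv_prod)
      then show ?case using J by (simp add: mv_ideals_def)
    next
      case (insert k S)
      have "mv_cut \<Omega> A {k} x \<in> J"
        using x insert.prems by (auto simp: mv_slice_def PiE_iff cut_single)
      then have "mv_cut \<Omega> A {k} x \<oplus>\<^bsub>mv_prod \<Omega> A\<^esub> mv_cut \<Omega> A S x \<in> J"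
        using J insert by (auto simp: mv_ideals_def)
      then show ?case
        using mv_cut_Un[OF xc, of "{k}" S] insert.hyps by simp
    qed
    then have "mv_cut \<Omega> A \<Omega> x \<in> J"
      using \<open>finite \<Omega>\<close> by simp
    \<comment> \<open>Off \<open>\<Omega>\<close> both sides are \<open>undefined\<close>, since
      \<open>x\<close> is extensional.\<close>
    moreover have "mv_cut \<Omega> A \<Omega> x = x"
      using x by (auto simp: mv_cut_def PiE_iff extensional_def fun_eq_iff)
    ultimately show "x \<in> J" by simp
  qed
qed

end

theorem proposition2p11:
  fixes \<Omega> :: "'i set" and A :: "'i \<Rightarrow> ('a, 'm) mv_scheme"
  assumes "finite \<Omega>"
    and "\<And>i. i \<in> \<Omega> \<Longrightarrow> mv_algebra (A i)"
  shows "{(\<Pi>\<^sub>E i\<in>\<Omega>. I i) | I. \<forall>i\<in>\<Omega>. I i \<in> mv_ideals (A i)} = mv_ideals (mv_prod \<Omega> A)"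
proof (intro equalityI subsetI)
  fix J assume "J \<in> {(\<Pi>\<^sub>E i\<in>\<Omega>. I i) | I. \<forall>i\<in>\<Omega>. I i \<in> mv_ideals (A i)}"
  then show "J \<in> mv_ideals (mv_prod \<Omega> A)"
    by (auto intro: PiE_mv_ideals)
next
  fix J assume J: "J \<in> mv_ideals (mv_prod \<Omega> A)"
  have "J = (\<Pi>\<^sub>E i\<in>\<Omega>. mv_slice \<Omega> A J i)"
    using PiE_mv_slice[of \<Omega> A J] assms J by simp
  moreover have "\<forall>i\<in>\<Omega>. mv_slice \<Omega> A J i \<in> mv_ideals (A i)"
    using mv_slice_mv_ideals[of \<Omega> A J] assms(2) J by simp
  ultimately show "J \<in> {(\<Pi>\<^sub>E i\<in>\<Omega>. I i) | I. \<forall>i\<in>\<Omega>. I i \<in> mv_ideals (A i)}"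
    by blast
qed

end
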